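(* Let $\mathbf{V}$ be a nontrivial variety of lattices, $\mathcal{L}=(L_i \mid i\in I)$ a family of lattices in $\mathbf{V}$, $L=\mathrm{Free}_{\mathbf{V}}\mathcal{L}$, and $\varphi_i\colon L_i\to M$ a family of join-semilattice homomorphisms from the $L_i$ to a common lattice $M$, not necessarily belonging to $\mathbf{V}$. If the image-sets $\varphi_i(L_i)$ have a common lower bound $e\in M$, then there exists a join-semilattice homomorphism $\varphi\colon L\to M$ whose restrictions to the $L_i\subseteq L$ are the $\varphi_i$. In particular, this is so if $M$ has a least element, or if $I$ is finite and every $L_i$ has a least element.
   Context: Lattices are nonempty. A variety of lattices is nontrivial if it has a member with more than one element. A join-semilattice homomorphism is a map preserving binary joins. $\mathrm{Free}_{\mathbf{V}}\mathcal{L}$ denotes the free product of the $L_i$ in $\mathbf{V}$: a lattice in $\mathbf{V}$ with lattice homomorphisms from the $L_i$, universal among families of lattice homomorphisms from the $L_i$ to a common lattice in $\mathbf{V}$ (the coproduct in $\mathbf{V}$). The canonical maps $L_i\to L$ are embeddings, and each $L_i$ is identified with its image. *)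

theory Defs
  imports "HOL-Algebra.Lattice" "HOL-Library.FuncSet"
begin

definition nonempty_lattice :: "'a gorder \<Rightarrow> bool" where
  "nonempty_lattice K \<longleftrightarrow> lattice K \<and> carrier K \<noteq> {}"

definition join_hom :: "'a gorder \<Rightarrow> 'b gorder \<Rightarrow> ('a \<Rightarrow> 'b) \<Rightarrow> bool" where
  "join_hom A B h \<longleftrightarrow> h \<in> carrier A \<rightarrow> carrier B \<and> join_pres A B h"

definition lattice_hom :: "'a gorder \<Rightarrow> 'b gorder \<Rightarrow> ('a \<Rightarrow> 'b) \<Rightarrow> bool" where
  "lattice_hom A B h \<longleftrightarrow> join_hom A B h \<and> meet_pres A B h"

datatype 'v lterm = LVar 'v | LJoin "'v lterm" "'v lterm" | LMeet "'v lterm" "'v lterm"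

primrec lterm_val :: "'a gorder \<Rightarrow> ('v \<Rightarrow> 'a) \<Rightarrow> 'v lterm \<Rightarrow> 'a" where
  "lterm_val K \<rho> (LVar v) = \<rho> v"
| "lterm_val K \<rho> (LJoin s t) = lterm_val K \<rho> s \<squnion>\<^bsub>K\<^esub> lterm_val K \<rho> t"
| "lterm_val K \<rho> (LMeet s t) = lterm_val K \<rho> s \<sqinter>\<^bsub>K\<^esub> lterm_val K \<rho> t"

text \<open>A variety of lattices is an equational class.  As a proper class (its members live in
  arbitrary types) it is represented by a set \<open>E\<close> of lattice identities defining it.\<close>

type_synonym identities = "(nat lterm \<times> nat lterm) set"

definition in_variety :: "identities \<Rightarrow> 'a gorder \<Rightarrow> bool" where
  "in_variety E K \<longleftrightarrow> nonempty_lattice K \<and>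
     (\<forall>(s, t) \<in> E. \<forall>\<rho>. range \<rho> \<subseteq> carrier K \<longrightarrow> lterm_val K \<rho> s = lterm_val K \<rho> t)"

text \<open>\<open>universal_for I L F \<iota> K\<close>: every family of lattice homomorphisms \<open>L i \<rightarrow> K\<close> factors
  uniquely through \<open>\<iota>\<close>.  Maps out of \<open>F\<close> are taken extensional so that \<open>\<exists>!\<close> means uniqueness on
  the carrier.\<close>

definition universal_for ::
  "'i set \<Rightarrow> ('i \<Rightarrow> 'a gorder) \<Rightarrow> 'l gorder \<Rightarrow> ('i \<Rightarrow> 'a \<Rightarrow> 'l) \<Rightarrow> 'k gorder \<Rightarrow> bool" where
  "universal_for I L F \<iota> K \<longleftrightarrow>
     (\<forall>f. (\<forall>i\<in>I. lattice_hom (L i) K (f i)) \<longrightarrow>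
       (\<exists>!h. h \<in> extensional (carrier F) \<and> lattice_hom F K h \<and>
             (\<forall>i\<in>I. \<forall>x\<in>carrier (L i). h (\<iota> i x) = f i x)))"

text \<open>The free product (coproduct) in the variety.  A definition cannot quantify over the types of
  the test lattices \<open>K\<close>, so these are taken in one type: the lattice terms over
  \<open>'i \<times> 'a + 'l + 'l\<close>.  This type has room for a copy of every lattice generated by images of the
  \<open>L i\<close> and of two maps from \<open>F\<close>, which is all that existence and uniqueness of the factorization
  can depend on; theorem \<open>free_product_universal\<close> below proves the universal property for
  test lattices in every type.\<close>

definition is_free_product ::
  "identities \<Rightarrow> 'i set \<Rightarrow> ('i \<Rightarrow> 'a gorder) \<Rightarrow> 'l gorder \<Rightarrow> ('i \<Rightarrow> 'a \<Rightarrow> 'l) \<Rightarrow> bool" where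
  "is_free_product E I L F \<iota> \<longleftrightarrow>
     in_variety E F \<and> (\<forall>i\<in>I. lattice_hom (L i) F (\<iota> i)) \<and>
     (\<forall>K :: (('i \<times> 'a) + 'l + 'l) lterm gorder. in_variety E K \<longrightarrow> universal_for I L F \<iota> K)"


lemma lattice_homD:
  assumes "lattice_hom A B h"
  shows "lattice A" "lattice B" "\<And>x. x \<in> carrier A \<Longrightarrow> h x \<in> carrier B"
    "\<And>x y. x \<in> carrier A \<Longrightarrow> y \<in> carrier A \<Longrightarrow> h (x \<squnion>\<^bsub>A\<^esub> y) = h x \<squnion>\<^bsub>B\<^esub> h y"
    "\<And>x y. x \<in> carrier A \<Longrightarrow> y \<in> carrier A \<Longrightarrow> h (x \<sqinter>\<^bsub>A\<^esub> y) = h x \<sqinter>\<^bsub>B\<^esub> h y"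
  using assms unfolding lattice_hom_def join_hom_def join_pres_def meet_pres_def by auto

lemma lattice_homI:
  assumes "lattice A" "lattice B" "\<And>x. x \<in> carrier A \<Longrightarrow> h x \<in> carrier B"
    "\<And>x y. x \<in> carrier A \<Longrightarrow> y \<in> carrier A \<Longrightarrow> h (x \<squnion>\<^bsub>A\<^esub> y) = h x \<squnion>\<^bsub>B\<^esub> h y"
    "\<And>x y. x \<in> carrier A \<Longrightarrow> y \<in> carrier A \<Longrightarrow> h (x \<sqinter>\<^bsub>A\<^esub> y) = h x \<sqinter>\<^bsub>B\<^esub> h y"
  shows "lattice_hom A B h"
  using assms unfolding lattice_hom_def join_hom_def join_pres_def meet_pres_def by auto

lemma lattice_join_closed: "lattice K \<Longrightarrow> x \<in> carrier K \<Longrightarrow> y \<in> carrier K \<Longrightarrow> x \<squnion>\<^bsub>K\<^esub> y \<in> carrier K"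
proof -
  assume "lattice K" and *: "x \<in> carrier K" "y \<in> carrier K"
  then interpret K: lattice K by simp
  show ?thesis using * by simp
qed

lemma lattice_meet_closed: "lattice K \<Longrightarrow> x \<in> carrier K \<Longrightarrow> y \<in> carrier K \<Longrightarrow> x \<sqinter>\<^bsub>K\<^esub> y \<in> carrier K"
proof -
  assume "lattice K" and *: "x \<in> carrier K" "y \<in> carrier K"
  then interpret K: lattice K by simp
  show ?thesis using * by simp
qed

lemma lattice_hom_comp:
  assumes "lattice_hom A B g" "lattice_hom B C h"
  shows "lattice_hom A C (h \<circ> g)"
  using lattice_homD[OF assms(1)] lattice_homD[OF assms(2)] by (intro lattice_homI) auto

lemma lattice_hom_restrict:
  assumes "lattice_hom A B h"
  shows "lattice_hom A B (restrict h (carrier A))"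
  using lattice_homD[OF assms]
  by (intro lattice_homI) (auto simp: lattice_join_closed lattice_meet_closed)

lemma lattice_hom_const:
  assumes "lattice A" "lattice B" "c \<in> carrier B"
  shows "lattice_hom A B (\<lambda>_. c)"
proof -
  interpret B: lattice B by fact
  have "c \<squnion>\<^bsub>B\<^esub> c = c" "c \<sqinter>\<^bsub>B\<^esub> c = c"
    using assms(3) B.le_iff_meet[of c c] B.le_iff_join[of c c] by auto
  then show ?thesis using assms by (intro lattice_homI) auto
qed

lemma lterm_val_closed:
  assumes "lattice K" "range \<rho> \<subseteq> carrier K"
  shows "lterm_val K \<rho> t \<in> carrier K"
  using assms by (induction t) (auto simp: lattice_join_closed lattice_meet_closed)

lemma lattice_hom_lterm_val:
  assumes "lattice_hom A B h" "range \<rho> \<subseteq> carrier A"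
  shows "h (lterm_val A \<rho> t) = lterm_val B (h \<circ> \<rho>) t"
  using lattice_homD[OF assms(1)] assms(2) by (induction t) (auto simp: lterm_val_closed)

lemma in_variety_inj_hom:
  assumes e: "lattice_hom A B e" and inj: "inj_on e (carrier A)"
    and "carrier A \<noteq> {}" "in_variety E B"
  shows "in_variety E A"
proof -
  note D = lattice_homD[OF e]
  have "lterm_val A \<rho> s = lterm_val A \<rho> t" if "(s, t) \<in> E" and \<rho>: "range \<rho> \<subseteq> carrier A" for s t \<rho>
  proof -
    have "range (e \<circ> \<rho>) \<subseteq> carrier B" using D(3) \<rho> by auto
    then have "lterm_val B (e \<circ> \<rho>) s = lterm_val B (e \<circ> \<rho>) t"
      using assms(4) that unfolding in_variety_def by fastforce
    then have "e (lterm_val A \<rho> s) = e (lterm_val A \<rho> t)"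
      by (simp add: lattice_hom_lterm_val[OF e \<rho>])
    then show ?thesis
      using inj lterm_val_closed[OF D(1) \<rho>] by (simp add: inj_on_eq_iff)
  qed
  then show ?thesis
    using D(1) assms(3) unfolding in_variety_def nonempty_lattice_def by auto
qed

lemma lattice_hom_lift:
  assumes e: "lattice_hom A B e" and inj: "inj_on e (carrier A)"
    and g: "lattice_hom C B g" and sub: "g ` carrier C \<subseteq> e ` carrier A"
  shows "lattice_hom C A (inv_into (carrier A) e \<circ> g)"
proof -
  note D = lattice_homD[OF e] and G = lattice_homD[OF g]
  let ?j = "inv_into (carrier A) e"
  have j: "?j (g x) \<in> carrier A" "e (?j (g x)) = g x" if "x \<in> carrier C" for x
    using sub that by (auto simp: inv_into_into f_inv_into_f image_subset_iff)
  have eqI: "x = y" if "x \<in> carrier A" "y \<in> carrier A" "e x = e y" for x y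
    using inj that by (auto dest: inj_onD)
  show ?thesis
  proof (intro lattice_homI)
    fix x y assume xy: "x \<in> carrier C" "y \<in> carrier C"
    note cl = lattice_join_closed[OF G(1) xy] lattice_meet_closed[OF G(1) xy]
    show "(?j \<circ> g) (x \<squnion>\<^bsub>C\<^esub> y) = (?j \<circ> g) x \<squnion>\<^bsub>A\<^esub> (?j \<circ> g) y"
      using xy j j(1)[OF cl(1)] j(2)[OF cl(1)]
      by (intro eqI) (simp_all add: D(4) G(4) lattice_join_closed[OF D(1)])
    show "(?j \<circ> g) (x \<sqinter>\<^bsub>C\<^esub> y) = (?j \<circ> g) x \<sqinter>\<^bsub>A\<^esub> (?j \<circ> g) y"
      using xy j j(1)[OF cl(2)] j(2)[OF cl(2)]
      by (intro eqI) (simp_all add: D(5) G(5) lattice_meet_closed[OF D(1)])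
  qed (use D G j in auto)
qed

lemma generated_copy:
  fixes K :: "'k gorder" and \<rho> :: "'v \<Rightarrow> 'k"
  assumes K: "lattice K" and \<rho>: "range \<rho> \<subseteq> carrier K"
  obtains A :: "'v lterm gorder" and e where
    "lattice_hom A K e" "inj_on e (carrier A)" "e ` carrier A = range (lterm_val K \<rho>)"
proof -
  interpret K: lattice K by fact
  define e where "e = lterm_val K \<rho>"
  define j where "j k = (SOME t. e t = k)" for k
  define A :: "'v lterm gorder" where "A = \<lparr>carrier = j ` range e, eq = (=), le = (\<lambda>s t. e s \<sqsubseteq>\<^bsub>K\<^esub> e t)\<rparr>"
  have ej: "e (j (e t)) = e t" for t
    unfolding j_def by (rule someI[where P = "\<lambda>t'. e t' = e t"]) simp
  have e_closed [simp]: "e t \<in> carrier K" for t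
    unfolding e_def using lterm_val_closed[OF K \<rho>] .
  have inj: "inj_on e (carrier A)"
    unfolding A_def by (auto simp: inj_on_def ej)
  have je: "j (e t) \<in> carrier A" for t by (auto simp: A_def)
  have le: "s \<sqsubseteq>\<^bsub>A\<^esub> t \<longleftrightarrow> e s \<sqsubseteq>\<^bsub>K\<^esub> e t" for s t by (simp add: A_def)
  interpret A: partial_order A
  proof
    have "x = y" if "x \<sqsubseteq>\<^bsub>A\<^esub> y" "y \<sqsubseteq>\<^bsub>A\<^esub> x" "x \<in> carrier A" "y \<in> carrier A" for x y
      using that inj K.le_antisym[of "e x" "e y"] unfolding le by (auto dest: inj_onD)
    then show "x .=\<^bsub>A\<^esub> y" if "x \<sqsubseteq>\<^bsub>A\<^esub> y" "y \<sqsubseteq>\<^bsub>A\<^esub> x" "x \<in> carrier A" "y \<in> carrier A" for x y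
      using that by (simp add: A_def)
    show "x \<sqsubseteq>\<^bsub>A\<^esub> z" if "x \<sqsubseteq>\<^bsub>A\<^esub> y" "y \<sqsubseteq>\<^bsub>A\<^esub> z" for x y z
      using that K.le_trans[of "e x" "e y" "e z"] unfolding le by simp
  qed (auto simp: A_def)
  have lub: "least A (j (e (LJoin x y))) (Upper A {x, y})"
    if "x \<in> carrier A" "y \<in> carrier A" for x y
  proof (rule least_UpperI)
    fix z assume "z \<in> {x, y}"
    then show "z \<sqsubseteq>\<^bsub>A\<^esub> j (e (LJoin x y))"
      using K.join_left[of "e x" "e y"] K.join_right[of "e x" "e y"]
      by (auto simp: le ej) (simp_all add: e_def)
  next
    fix z assume "z \<in> Upper A {x, y}"
    then have "e x \<sqsubseteq>\<^bsub>K\<^esub> e z" "e y \<sqsubseteq>\<^bsub>K\<^esub> e z"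
      using that by (auto simp: Upper_def le)
    then have "e x \<squnion>\<^bsub>K\<^esub> e y \<sqsubseteq>\<^bsub>K\<^esub> e z" by (intro K.join_le) auto
    then show "j (e (LJoin x y)) \<sqsubseteq>\<^bsub>A\<^esub> z" by (simp add: le ej) (simp add: e_def)
  qed (use that je in auto)
  have glb: "greatest A (j (e (LMeet x y))) (Lower A {x, y})"
    if "x \<in> carrier A" "y \<in> carrier A" for x y
  proof (rule greatest_LowerI)
    fix z assume "z \<in> {x, y}"
    then show "j (e (LMeet x y)) \<sqsubseteq>\<^bsub>A\<^esub> z"
      using K.meet_left[of "e x" "e y"] K.meet_right[of "e x" "e y"]
      by (auto simp: le ej) (simp_all add: e_def)
  next
    fix z assume "z \<in> Lower A {x, y}"
    then have "e z \<sqsubseteq>\<^bsub>K\<^esub> e x" "e z \<sqsubseteq>\<^bsub>K\<^esub> e y"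
      using that by (auto simp: Lower_def le)
    then have "e z \<sqsubseteq>\<^bsub>K\<^esub> e x \<sqinter>\<^bsub>K\<^esub> e y" by (intro K.meet_le) auto
    then show "z \<sqsubseteq>\<^bsub>A\<^esub> j (e (LMeet x y))" by (simp add: le ej) (simp add: e_def)
  qed (use that je in auto)
  interpret A: lattice A
    by unfold_locales (use lub glb in blast)+
  have join: "x \<squnion>\<^bsub>A\<^esub> y = j (e (LJoin x y))" if "x \<in> carrier A" "y \<in> carrier A" for x y
    using A.sup_of_two_least[OF that] lub[OF that] A.least_unique by (simp add: join_def)
  have meet: "x \<sqinter>\<^bsub>A\<^esub> y = j (e (LMeet x y))" if "x \<in> carrier A" "y \<in> carrier A" for x y
    using A.inf_of_two_greatest[OF that] glb[OF that] A.greatest_unique by (simp add: meet_def)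
  have "lattice_hom A K e"
    using A.lattice_axioms K by (intro lattice_homI) (auto simp: join meet ej, simp_all add: e_def)
  moreover have "e ` carrier A = range e" by (auto simp: A_def ej image_image)
  ultimately show ?thesis using inj that by (auto simp: e_def)
qed

theorem free_product_universal:
  fixes F :: "'l gorder" and L :: "'i \<Rightarrow> 'a gorder" and K :: "'k gorder"
  assumes F: "is_free_product E I L F \<iota>" and K: "in_variety E K"
  shows "universal_for I L F \<iota> K"
proof -
  have latK: "lattice K" and Kne: "carrier K \<noteq> {}"
    using K by (auto simp: in_variety_def nonempty_lattice_def)
  have \<iota>: "lattice_hom (L i) F (\<iota> i)" if "i \<in> I" for i
    using F that by (simp add: is_free_product_def)
  have latF: "lattice F" using F by (auto simp: is_free_product_def in_variety_def nonempty_lattice_def)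
  obtain c where c: "c \<in> carrier K" using Kne by blast
  have copy: "\<exists>(A :: (('i \<times> 'a) + 'l + 'l) lterm gorder) e.
      universal_for I L F \<iota> A \<and> lattice_hom A K e \<and> inj_on e (carrier A) \<and> range \<rho> \<subseteq> e ` carrier A"
    if \<rho>: "range \<rho> \<subseteq> carrier K" for \<rho> :: "('i \<times> 'a) + 'l + 'l \<Rightarrow> 'k"
  proof -
    obtain A :: "(('i \<times> 'a) + 'l + 'l) lterm gorder" and e where
      e: "lattice_hom A K e" "inj_on e (carrier A)" "e ` carrier A = range (lterm_val K \<rho>)"
      using generated_copy[OF latK \<rho>] .
    have "\<rho> v \<in> range (lterm_val K \<rho>)" for v
      by (rule range_eqI[where x = "LVar v"]) simp
    moreover have "in_variety E A" 
    proof (rule in_variety_inj_hom[OF e(1,2) _ K])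
      show "carrier A \<noteq> {}" using e(3) by auto
    qed
    ultimately show ?thesis using F e unfolding is_free_product_def by blast
  qed
  show ?thesis
    unfolding universal_for_def
  proof (intro allI impI ex_ex1I)
    fix f assume f: "\<forall>i\<in>I. lattice_hom (L i) K (f i)"
    define \<rho> :: "('i \<times> 'a) + 'l + 'l \<Rightarrow> 'k" where
      "\<rho> v = (case v of Inl (i, x) \<Rightarrow> if i \<in> I \<and> x \<in> carrier (L i) then f i x else c | Inr _ \<Rightarrow> c)" for v
    have "range \<rho> \<subseteq> carrier K"
      using c lattice_homD(3)[OF f[rule_format]] by (auto simp: \<rho>_def split: sum.splits)
    from copy[OF this] obtain A :: "(('i \<times> 'a) + 'l + 'l) lterm gorder" and e where
      e: "universal_for I L F \<iota> A" "lattice_hom A K e" "inj_on e (carrier A)" "range \<rho> \<subseteq> e ` carrier A"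
      by blast
    have im: "f i x \<in> e ` carrier A" if "i \<in> I" "x \<in> carrier (L i)" for i x
    proof -
      have "\<rho> (Inl (i, x)) = f i x" using that by (simp add: \<rho>_def)
      then show ?thesis using e(4) by (metis rangeI subsetD)
    qed
    define g where "g i = inv_into (carrier A) e \<circ> f i" for i
    have "\<forall>i\<in>I. lattice_hom (L i) A (g i)"
      unfolding g_def using f im by (auto intro!: lattice_hom_lift[OF e(2,3)])
    then obtain h where h: "lattice_hom F A h" "\<forall>i\<in>I. \<forall>x\<in>carrier (L i). h (\<iota> i x) = g i x"
      using e(1) unfolding universal_for_def by blast
    have "lattice_hom F K (restrict (e \<circ> h) (carrier F))"
      using lattice_hom_comp[OF h(1) e(2)] lattice_hom_restrict by blast
    moreover have "restrict (e \<circ> h) (carrier F) (\<iota> i x) = f i x" if "i \<in> I" "x \<in> carrier (L i)" for i x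
      using that h(2) im[OF that] lattice_homD(3)[OF \<iota>] by (simp add: g_def f_inv_into_f)
    ultimately show "\<exists>h. h \<in> extensional (carrier F) \<and> lattice_hom F K h \<and>
             (\<forall>i\<in>I. \<forall>x\<in>carrier (L i). h (\<iota> i x) = f i x)"
      by (intro exI[of _ "restrict (e \<circ> h) (carrier F)"]) auto
  next
    fix f h h'
    assume f: "\<forall>i\<in>I. lattice_hom (L i) K (f i)"
    assume "h \<in> extensional (carrier F) \<and> lattice_hom F K h \<and>
             (\<forall>i\<in>I. \<forall>x\<in>carrier (L i). h (\<iota> i x) = f i x)"
      and "h' \<in> extensional (carrier F) \<and> lattice_hom F K h' \<and>
             (\<forall>i\<in>I. \<forall>x\<in>carrier (L i). h' (\<iota> i x) = f i x)"
    then have ext: "h \<in> extensional (carrier F)" "h' \<in> extensional (carrier F)"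
      and hom: "lattice_hom F K h" "lattice_hom F K h'"
      and agree: "\<And>i x. i \<in> I \<Longrightarrow> x \<in> carrier (L i) \<Longrightarrow> h (\<iota> i x) = f i x"
                 "\<And>i x. i \<in> I \<Longrightarrow> x \<in> carrier (L i) \<Longrightarrow> h' (\<iota> i x) = f i x"
      by auto
    define \<rho> :: "('i \<times> 'a) + 'l + 'l \<Rightarrow> 'k" where
      "\<rho> v = (case v of Inl _ \<Rightarrow> c | Inr (Inl y) \<Rightarrow> if y \<in> carrier F then h y else c
                      | Inr (Inr y) \<Rightarrow> if y \<in> carrier F then h' y else c)" for v
    have "range \<rho> \<subseteq> carrier K"
      using c hom by (auto simp: \<rho>_def lattice_homD split: sum.splits)
    from copy[OF this] obtain A :: "(('i \<times> 'a) + 'l + 'l) lterm gorder" and e where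
      e: "universal_for I L F \<iota> A" "lattice_hom A K e" "inj_on e (carrier A)" "range \<rho> \<subseteq> e ` carrier A"
      by blast
    have im: "h y \<in> e ` carrier A" "h' y \<in> e ` carrier A" if "y \<in> carrier F" for y
    proof -
      have "\<rho> (Inr (Inl y)) = h y" "\<rho> (Inr (Inr y)) = h' y" using that by (simp_all add: \<rho>_def)
      then show "h y \<in> e ` carrier A" "h' y \<in> e ` carrier A" using e(4) by (metis rangeI subsetD)+
    qed
    let ?j = "inv_into (carrier A) e"
    define k where "k = restrict (?j \<circ> h) (carrier F)"
    define k' where "k' = restrict (?j \<circ> h') (carrier F)"
    have k: "lattice_hom F A k" "lattice_hom F A k'"
      unfolding k_def k'_def using im
      by (auto intro!: lattice_hom_restrict lattice_hom_lift[OF e(2,3)] hom)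
    have "\<forall>i\<in>I. lattice_hom (L i) A (k \<circ> \<iota> i)" using lattice_hom_comp[OF \<iota> k(1)] by blast
    then have "\<exists>!q. q \<in> extensional (carrier F) \<and> lattice_hom F A q \<and>
             (\<forall>i\<in>I. \<forall>x\<in>carrier (L i). q (\<iota> i x) = (k \<circ> \<iota> i) x)"
      using e(1) unfolding universal_for_def by (elim allE[where x = "\<lambda>i. k \<circ> \<iota> i"]) blast
    moreover have "k' (\<iota> i x) = (k \<circ> \<iota> i) x" if "i \<in> I" "x \<in> carrier (L i)" for i x
      using agree that lattice_homD(3)[OF \<iota>] by (simp add: k_def k'_def)
    moreover have "k \<in> extensional (carrier F)" "k' \<in> extensional (carrier F)"
      by (simp_all add: k_def k'_def)
    ultimately have kk: "k = k'" using k by auto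
    have "h y = h' y" if "y \<in> carrier F" for y
    proof -
      have "e (k y) = h y" "e (k' y) = h' y"
        using im[OF that] that by (simp_all add: k_def k'_def f_inv_into_f)
      then show ?thesis using kk by simp
    qed
    then show "h = h'" using ext by (meson extensionalityI)
  qed
qed

text \<open>The canonical maps are embeddings, so that \<open>L i\<close> may be identified with its image and
  restriction to \<open>L i\<close> means composition with \<open>\<iota> i\<close>.\<close>

theorem free_product_embedding:
  assumes F: "is_free_product E I L F \<iota>" and V: "\<And>i. i \<in> I \<Longrightarrow> in_variety E (L i)" and i: "i \<in> I"
  shows "inj_on (\<iota> i) (carrier (L i))"
proof -
  have lat: "lattice (L k)" "carrier (L k) \<noteq> {}" if "k \<in> I" for k
    using V[OF that] by (auto simp: in_variety_def nonempty_lattice_def)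
  obtain c where c: "c \<in> carrier (L i)" using lat[OF i] by blast
  define f where "f k = (if k = i then id else (\<lambda>_. c))" for k
  have "\<forall>k\<in>I. lattice_hom (L k) (L i) (f k)"
    using lat i c by (auto simp: f_def intro!: lattice_hom_const intro: lattice_homI)
  then obtain h where "\<forall>k\<in>I. \<forall>x\<in>carrier (L k). h (\<iota> k x) = f k x"
    using free_product_universal[OF F V[OF i]] unfolding universal_for_def by blast
  then have "h (\<iota> i x) = x" if "x \<in> carrier (L i)" for x using that i by (simp add: f_def)
  then show ?thesis by (metis inj_onI)
qed

end

theory Submission
  imports Defs
begin

text \<open>Adjoining a new least element \<open>None\<close> to a lattice of a nontrivial variety does not leave the
  variety.  Hence the free product has homomorphisms \<open>h i\<close> into \<open>L i\<close> with \<open>None\<close> adjoined that are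
  the identity on \<open>L i\<close> and \<open>None\<close> on the other factors.  As the free product is generated by the
  \<open>L i\<close>, only finitely many \<open>h i x\<close> differ from \<open>None\<close> for each \<open>x\<close>, so that the join of \<open>e\<close> and of
  the \<open>\<phi> i (h i x)\<close> for these \<open>i\<close> exists in \<open>M\<close>.  As a function of \<open>x\<close> it preserves joins, and it
  extends the \<open>\<phi> i\<close> because \<open>e\<close> is a common lower bound.\<close>

section \<open>Adjoining a least element to a lattice\<close>

definition adjoin_bot :: "'a gorder \<Rightarrow> 'a option gorder" where
  "adjoin_bot A = \<lparr>carrier = insert None (Some ` carrier A), eq = (=),
     le = (\<lambda>x y. case x of None \<Rightarrow> True
       | Some a \<Rightarrow> (case y of None \<Rightarrow> False | Some b \<Rightarrow> a \<sqsubseteq>\<^bsub>A\<^esub> b))\<rparr>"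

lemma adjoin_bot_simps [simp]:
  "None \<in> carrier (adjoin_bot A)"
  "Some a \<in> carrier (adjoin_bot A) \<longleftrightarrow> a \<in> carrier A"
  "None \<sqsubseteq>\<^bsub>adjoin_bot A\<^esub> y"
  "\<not> Some a \<sqsubseteq>\<^bsub>adjoin_bot A\<^esub> None"
  "Some a \<sqsubseteq>\<^bsub>adjoin_bot A\<^esub> Some b \<longleftrightarrow> a \<sqsubseteq>\<^bsub>A\<^esub> b"
  "x .=\<^bsub>adjoin_bot A\<^esub> y \<longleftrightarrow> x = y"
  by (auto simp: adjoin_bot_def)

lemma adjoin_bot_carrierE:
  assumes "x \<in> carrier (adjoin_bot A)"
  obtains "x = None" | a where "x = Some a" "a \<in> carrier A"
  using assms by (auto simp: adjoin_bot_def)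

text \<open>The operations of \<open>adjoin_bot A\<close> are suprema and infima obtained by choice.
  This explicit form, like \<open>bot_meet\<close> below, lets later arguments compute with them by
  cases on \<open>None\<close>.\<close>

fun bot_join :: "'a gorder \<Rightarrow> 'a option \<Rightarrow> 'a option \<Rightarrow> 'a option" where
  "bot_join A (Some a) (Some b) = Some (a \<squnion>\<^bsub>A\<^esub> b)"
| "bot_join A None y = y"
| "bot_join A x None = x"

fun bot_meet :: "'a gorder \<Rightarrow> 'a option \<Rightarrow> 'a option \<Rightarrow> 'a option" where
  "bot_meet A (Some a) (Some b) = Some (a \<sqinter>\<^bsub>A\<^esub> b)"
| "bot_meet A None y = None"
| "bot_meet A x None = None"

lemma bot_join_None_right [simp]: "bot_join A x None = x"
  by (cases x) auto

lemma bot_meet_None_right [simp]: "bot_meet A x None = None"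
  by (cases x) auto

lemma
  assumes "lattice A"
  shows lattice_adjoin_bot: "lattice (adjoin_bot A)"
    and adjoin_bot_join: "\<And>x y. \<lbrakk>x \<in> carrier (adjoin_bot A); y \<in> carrier (adjoin_bot A)\<rbrakk>
      \<Longrightarrow> x \<squnion>\<^bsub>adjoin_bot A\<^esub> y = bot_join A x y"
    and adjoin_bot_meet: "\<And>x y. \<lbrakk>x \<in> carrier (adjoin_bot A); y \<in> carrier (adjoin_bot A)\<rbrakk>
      \<Longrightarrow> x \<sqinter>\<^bsub>adjoin_bot A\<^esub> y = bot_meet A x y"
proof -
  interpret A: lattice A by fact
  let ?B = "adjoin_bot A"
  interpret B: partial_order ?B
  proof
    fix x y z assume "x \<in> carrier ?B" "y \<in> carrier ?B" "z \<in> carrier ?B"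
      and "x \<sqsubseteq>\<^bsub>?B\<^esub> y" "y \<sqsubseteq>\<^bsub>?B\<^esub> z"
    then show "x \<sqsubseteq>\<^bsub>?B\<^esub> z"
      by (auto elim!: adjoin_bot_carrierE intro: A.le_trans)
  qed (auto elim!: adjoin_bot_carrierE intro: A.le_antisym simp: fun_eq_iff)
  have lub: "least ?B (bot_join A x y) (Upper ?B {x, y})"
    if "x \<in> carrier ?B" "y \<in> carrier ?B" for x y
  proof (rule least_UpperI)
    show "z \<sqsubseteq>\<^bsub>?B\<^esub> bot_join A x y" if "z \<in> {x, y}" for z
      using that \<open>x \<in> carrier ?B\<close> \<open>y \<in> carrier ?B\<close>
      by (auto elim!: adjoin_bot_carrierE simp: A.join_left A.join_right)
    fix z assume "z \<in> Upper ?B {x, y}"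
    then have "x \<sqsubseteq>\<^bsub>?B\<^esub> z" "y \<sqsubseteq>\<^bsub>?B\<^esub> z" "z \<in> carrier ?B"
      using that unfolding Upper_def by blast+
    then show "bot_join A x y \<sqsubseteq>\<^bsub>?B\<^esub> z"
      using that by (auto elim!: adjoin_bot_carrierE simp: A.join_le)
  qed (use that in \<open>auto elim!: adjoin_bot_carrierE\<close>)
  have glb: "greatest ?B (bot_meet A x y) (Lower ?B {x, y})"
    if "x \<in> carrier ?B" "y \<in> carrier ?B" for x y
  proof (rule greatest_LowerI)
    show "bot_meet A x y \<sqsubseteq>\<^bsub>?B\<^esub> z" if "z \<in> {x, y}" for z
      using that \<open>x \<in> carrier ?B\<close> \<open>y \<in> carrier ?B\<close>
      by (auto elim!: adjoin_bot_carrierE simp: A.meet_left A.meet_right)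
    fix z assume "z \<in> Lower ?B {x, y}"
    then have "z \<sqsubseteq>\<^bsub>?B\<^esub> x" "z \<sqsubseteq>\<^bsub>?B\<^esub> y" "z \<in> carrier ?B"
      using that unfolding Lower_def by blast+
    then show "z \<sqsubseteq>\<^bsub>?B\<^esub> bot_meet A x y"
      using that by (auto elim!: adjoin_bot_carrierE simp: A.meet_le)
  qed (use that in \<open>auto elim!: adjoin_bot_carrierE\<close>)
  interpret B: lattice ?B
    by unfold_locales (use lub glb in blast)+
  show "lattice ?B" by (rule B.lattice_axioms)
  fix x y assume xy: "x \<in> carrier ?B" "y \<in> carrier ?B"
  show "x \<squnion>\<^bsub>?B\<^esub> y = bot_join A x y"
    using B.sup_of_two_least[OF xy] lub[OF xy] B.least_unique by (simp add: join_def)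
  show "x \<sqinter>\<^bsub>?B\<^esub> y = bot_meet A x y"
    using B.inf_of_two_greatest[OF xy] glb[OF xy] B.greatest_unique by (simp add: meet_def)
qed

lemma lattice_hom_Some: "lattice A \<Longrightarrow> lattice_hom A (adjoin_bot A) Some"
  by (intro lattice_homI) (auto simp: lattice_adjoin_bot adjoin_bot_join adjoin_bot_meet)

section \<open>Terms and identities with an adjoined least element\<close>

text \<open>A lattice need not have a least element, but a term has only finitely many variables, so
  the proper values assigned to them have a common lower bound in \<open>A\<close>. It will stand in
  for \<open>None\<close> when an identity is transferred from \<open>A\<close>.\<close>

lemma lterm_lower_bound:
  assumes "lattice A" "carrier A \<noteq> {}" "range \<rho> \<subseteq> carrier (adjoin_bot A)"
  shows "\<exists>z\<in>carrier A. \<forall>v\<in>set_lterm t. \<forall>a. \<rho> v = Some a \<longrightarrow> z \<sqsubseteq>\<^bsub>A\<^esub> a"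
proof -
  interpret A: lattice A by fact
  have \<rho>: "a \<in> carrier A" if "\<rho> v = Some a" for v a
    using assms(3) that by (metis adjoin_bot_simps(2) rangeI subsetD)
  \<comment> \<open>Joins and meets of terms both unite the variable sets of the subterms, so the
    meet of two bounds settles both induction steps.\<close>
  have *: "\<exists>z\<in>carrier A. \<forall>v\<in>S \<union> T. \<forall>a. \<rho> v = Some a \<longrightarrow> z \<sqsubseteq>\<^bsub>A\<^esub> a"
    if S: "\<exists>z\<in>carrier A. \<forall>v\<in>S. \<forall>a. \<rho> v = Some a \<longrightarrow> z \<sqsubseteq>\<^bsub>A\<^esub> a"
      and T: "\<exists>z\<in>carrier A. \<forall>v\<in>T. \<forall>a. \<rho> v = Some a \<longrightarrow> z \<sqsubseteq>\<^bsub>A\<^esub> a" for S T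
  proof -
    obtain y z where y: "y \<in> carrier A" "\<And>v a. v \<in> S \<Longrightarrow> \<rho> v = Some a \<Longrightarrow> y \<sqsubseteq>\<^bsub>A\<^esub> a"
      and z: "z \<in> carrier A" "\<And>v a. v \<in> T \<Longrightarrow> \<rho> v = Some a \<Longrightarrow> z \<sqsubseteq>\<^bsub>A\<^esub> a"
      using S T by blast
    have "y \<sqinter>\<^bsub>A\<^esub> z \<sqsubseteq>\<^bsub>A\<^esub> a" if "v \<in> S \<union> T" "\<rho> v = Some a" for v a
      using that y(2) z(2) A.meet_left[OF y(1) z(1)] A.meet_right[OF y(1) z(1)] \<rho>[OF that(2)]
        A.le_trans[OF _ _ A.meet_closed[OF y(1) z(1)]] y(1) z(1) by blast
    then show ?thesis using A.meet_closed[OF y(1) z(1)] by blast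
  qed
  show ?thesis
  proof (induction t)
    case (LVar v)
    show ?case
    proof (cases "\<rho> v")
      case None
      then show ?thesis using assms(2) by auto
    next
      case (Some a)
      then show ?thesis using A.le_refl[OF \<rho>[OF Some]] \<rho>[OF Some] by auto
    qed
  qed (auto intro!: *)
qed

text \<open>Apart from evaluation in \<open>A\<close> itself (\<open>g = id\<close>), this applies to a constant \<open>g\<close> into a
  two-element chain, which detects whether a term takes the value \<open>None\<close>.\<close>

lemma lterm_val_adjoin_bot:
  assumes g: "lattice_hom A K g" and \<rho>: "range \<rho> \<subseteq> carrier (adjoin_bot A)" and z: "z \<in> carrier K"
    and le: "\<forall>v\<in>set_lterm t. \<forall>a. \<rho> v = Some a \<longrightarrow> z \<sqsubseteq>\<^bsub>K\<^esub> g a"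
  shows "lterm_val K (\<lambda>v. case_option z g (\<rho> v)) t = case_option z g (lterm_val (adjoin_bot A) \<rho> t)
    \<and> z \<sqsubseteq>\<^bsub>K\<^esub> case_option z g (lterm_val (adjoin_bot A) \<rho> t)"
  using le
proof (induction t)
  case (LVar v)
  interpret K: lattice K by (rule lattice_homD(2)[OF g])
  show ?case using LVar z by (auto split: option.splits)
next
  note G = lattice_homD[OF g]
  interpret K: lattice K by (rule G(2))
  have cl: "lterm_val (adjoin_bot A) \<rho> s \<in> carrier (adjoin_bot A)" for s
    by (rule lterm_val_closed[OF lattice_adjoin_bot[OF G(1)] \<rho>])
  have le_join: "z \<sqsubseteq>\<^bsub>K\<^esub> a \<squnion>\<^bsub>K\<^esub> b" if "z \<sqsubseteq>\<^bsub>K\<^esub> a" "a \<in> carrier K" "b \<in> carrier K" for a b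
    using K.le_trans[OF that(1) K.join_left] that z by simp
  \<comment> \<open>A subterm with value \<open>None\<close> evaluates to \<open>z\<close> in
    \<open>K\<close>. Since \<open>z\<close> lies below the value of the other subterm, joining or
    meeting with it acts as \<open>None\<close> does. This uses the second conjunct of the claim for
    the subterms, so both conjuncts are proved together.\<close>
  have absorb: "z \<squnion>\<^bsub>K\<^esub> a = a" "a \<squnion>\<^bsub>K\<^esub> z = a" "z \<sqinter>\<^bsub>K\<^esub> a = z" "a \<sqinter>\<^bsub>K\<^esub> z = z"
    if "z \<sqsubseteq>\<^bsub>K\<^esub> a" "a \<in> carrier K" for a
    using K.le_iff_meet[OF z that(2)] K.le_iff_join[OF z that(2)] that(1)
      join_comm[of K a z] meet_comm[of K a z] by auto
  {
    case (LJoin s t)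
    have st: "\<forall>v\<in>set_lterm s. \<forall>a. \<rho> v = Some a \<longrightarrow> z \<sqsubseteq>\<^bsub>K\<^esub> g a"
      "\<forall>v\<in>set_lterm t. \<forall>a. \<rho> v = Some a \<longrightarrow> z \<sqsubseteq>\<^bsub>K\<^esub> g a"
      using LJoin.prems by auto
    note * = LJoin.IH(1)[OF st(1)] LJoin.IH(2)[OF st(2)]
    show ?case
      using * z cl[of s] cl[of t]
      by (auto elim!: adjoin_bot_carrierE simp: adjoin_bot_join[OF G(1)] G(3,4) absorb le_join)
  next
    case (LMeet s t)
    have st: "\<forall>v\<in>set_lterm s. \<forall>a. \<rho> v = Some a \<longrightarrow> z \<sqsubseteq>\<^bsub>K\<^esub> g a"
      "\<forall>v\<in>set_lterm t. \<forall>a. \<rho> v = Some a \<longrightarrow> z \<sqsubseteq>\<^bsub>K\<^esub> g a"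
      using LMeet.prems by auto
    note * = LMeet.IH(1)[OF st(1)] LMeet.IH(2)[OF st(2)]
    show ?case
      using * z cl[of s] cl[of t]
      by (auto elim!: adjoin_bot_carrierE simp: adjoin_bot_meet[OF G(1)] G(3,5) absorb intro!: K.meet_le)
  }
qed

lemma in_varietyD:
  assumes "in_variety E K" "(s, t) \<in> E" "\<And>v. \<rho> v \<in> carrier K"
  shows "lterm_val K \<rho> s = lterm_val K \<rho> t"
proof -
  have "range \<rho> \<subseteq> carrier K" using assms(3) by blast
  then show ?thesis using assms(1,2) unfolding in_variety_def by blast
qed

text \<open>Each identity is tested in two lattices. Sending \<open>None\<close> to \<open>p\<close>
  and all else to \<open>q\<close>, for \<open>p\<close> strictly below \<open>q\<close> in
  \<open>W\<close>, shows that its two sides are \<open>None\<close> simultaneously. Replacing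
  \<open>None\<close> by a low element \<open>z\<close> of \<open>A\<close> then compares their
  values in \<open>A\<close>. The second test alone would not tell \<open>None\<close> from
  \<open>Some z\<close>.\<close>

lemma in_variety_adjoin_bot:
  assumes W: "in_variety E W" "x \<in> carrier W" "y \<in> carrier W" "x \<noteq> y"
    and A: "in_variety E A"
  shows "in_variety E (adjoin_bot A)"
proof -
  have latW: "lattice W" and latA: "lattice A" "carrier A \<noteq> {}"
    using W(1) A by (auto simp: in_variety_def nonempty_lattice_def)
  interpret W: lattice W by fact
  obtain p q where pq: "p \<in> carrier W" "q \<in> carrier W" "p \<noteq> q" "p \<sqsubseteq>\<^bsub>W\<^esub> q"
  \<comment> \<open>If \<open>x\<close> is not below \<open>y\<close>, then \<open>y\<close> lies
    strictly below the join of \<open>x\<close> and \<open>y\<close>.\<close>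
  proof (cases "x \<sqsubseteq>\<^bsub>W\<^esub> y")
    case False
    then show ?thesis using that[of y "x \<squnion>\<^bsub>W\<^esub> y"] W W.le_iff_meet[of x y] W.join_right[of x y] by auto
  qed (use W that in blast)
  have "lterm_val (adjoin_bot A) \<rho> s = lterm_val (adjoin_bot A) \<rho> t" (is "?s = ?t")
    if st: "(s, t) \<in> E" and \<rho>: "range \<rho> \<subseteq> carrier (adjoin_bot A)" for s t \<rho>
  proof -
    have \<rho>': "a \<in> carrier A" if "\<rho> v = Some a" for v a
      using \<rho> that by (metis adjoin_bot_simps(2) rangeI subsetD)
    have "lterm_val W (\<lambda>v. case_option p (\<lambda>_. q) (\<rho> v)) s =
        lterm_val W (\<lambda>v. case_option p (\<lambda>_. q) (\<rho> v)) t"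
      using pq(1,2) by (intro in_varietyD[OF W(1) st]) (simp split: option.splits)
    then have "case_option p (\<lambda>_. q) ?s = case_option p (\<lambda>_. q) ?t"
      using lterm_val_adjoin_bot[OF lattice_hom_const[OF latA(1) latW pq(2)] \<rho> pq(1), of s]
        lterm_val_adjoin_bot[OF lattice_hom_const[OF latA(1) latW pq(2)] \<rho> pq(1), of t] pq(4) by simp
    then have null: "?s = None \<longleftrightarrow> ?t = None"
      using pq(3) by (auto split: option.splits)
    \<comment> \<open>\<open>LJoin s t\<close> serves only to collect the variables of both sides,
      so that one \<open>z\<close> works for \<open>s\<close> and \<open>t\<close>.\<close>
    obtain z where z: "z \<in> carrier A"
        "\<forall>v\<in>set_lterm (LJoin s t). \<forall>a. \<rho> v = Some a \<longrightarrow> z \<sqsubseteq>\<^bsub>A\<^esub> a"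
      using lterm_lower_bound[OF latA \<rho>] by blast
    have "lterm_val A (\<lambda>v. case_option z id (\<rho> v)) s = lterm_val A (\<lambda>v. case_option z id (\<rho> v)) t"
      using z(1) \<rho>' by (intro in_varietyD[OF A st]) (simp split: option.splits)
    moreover have "lattice_hom A A id" using latA(1) by (auto intro: lattice_homI)
    note val = lterm_val_adjoin_bot[OF this \<rho> z(1)]
    have "\<forall>v\<in>set_lterm s. \<forall>a. \<rho> v = Some a \<longrightarrow> z \<sqsubseteq>\<^bsub>A\<^esub> id a"
      "\<forall>v\<in>set_lterm t. \<forall>a. \<rho> v = Some a \<longrightarrow> z \<sqsubseteq>\<^bsub>A\<^esub> id a" using z(2) by auto
    note val[OF this(1)] val[OF this(2)]
    ultimately have "case_option z id ?s = case_option z id ?t" by simp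
    then show ?thesis using null by (auto split: option.splits)
  qed
  moreover have "carrier (adjoin_bot A) \<noteq> {}" using adjoin_bot_simps(1) by blast
  ultimately show ?thesis
    using lattice_adjoin_bot[OF latA(1)] unfolding in_variety_def nonempty_lattice_def by auto
qed

section \<open>Consequences of the universal property\<close>

lemma universal_for_ex1:
  assumes "universal_for I L F \<iota> K" "\<And>i. i \<in> I \<Longrightarrow> lattice_hom (L i) K (f i)"
  shows "\<exists>!h. h \<in> extensional (carrier F) \<and> lattice_hom F K h \<and>
    (\<forall>i\<in>I. \<forall>x\<in>carrier (L i). h (\<iota> i x) = f i x)"
proof -
  have "\<forall>i\<in>I. lattice_hom (L i) K (f i)" using assms(2) by blast
  then show ?thesis using assms(1) unfolding universal_for_def by (elim allE[where x = f]) (rule mp)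
qed

lemma universal_for_obtain:
  assumes "universal_for I L F \<iota> K" "\<And>i. i \<in> I \<Longrightarrow> lattice_hom (L i) K (f i)"
  obtains h where "lattice_hom F K h" "\<And>i x. i \<in> I \<Longrightarrow> x \<in> carrier (L i) \<Longrightarrow> h (\<iota> i x) = f i x"
  using ex1_implies_ex[OF universal_for_ex1[OF assms]] by blast

text \<open>Restricted to the carrier, \<open>g\<close> and \<open>h\<close> both factor the family
  \<open>h \<circ> \<iota> i\<close>. The restriction supplies the extensionality demanded by
  \<open>universal_for\<close>, so homomorphisms with arbitrary values outside the carrier, such as
  composites and \<open>id\<close>, can be compared.\<close>

lemma universal_for_unique:
  assumes univ: "universal_for I L F \<iota> K" and \<iota>: "\<And>i. i \<in> I \<Longrightarrow> lattice_hom (L i) F (\<iota> i)"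
    and g: "lattice_hom F K g" and h: "lattice_hom F K h"
    and eq: "\<And>i x. i \<in> I \<Longrightarrow> x \<in> carrier (L i) \<Longrightarrow> g (\<iota> i x) = h (\<iota> i x)"
    and y: "y \<in> carrier F"
  shows "g y = h y"
proof -
  let ?P = "\<lambda>q. q \<in> extensional (carrier F) \<and> lattice_hom F K q \<and>
    (\<forall>i\<in>I. \<forall>x\<in>carrier (L i). q (\<iota> i x) = (h \<circ> \<iota> i) x)"
  have "\<exists>!q. ?P q"
    using univ lattice_hom_comp[OF \<iota> h] by (rule universal_for_ex1)
  moreover have "?P (restrict g (carrier F))" "?P (restrict h (carrier F))"
    using lattice_hom_restrict[OF g] lattice_hom_restrict[OF h] lattice_homD(3)[OF \<iota>] eq by simp_all
  ultimately have "restrict g (carrier F) = restrict h (carrier F)" by (elim ex1E) metis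
  then show ?thesis using y by (metis restrict_apply')
qed

text \<open>The free product is generated by its factors. The sublattice generated by their images
  belongs to the variety, so \<open>F\<close> maps to it over the generators. Followed by the
  inclusion, this map is the identity by uniqueness, hence every element of \<open>F\<close> is the
  value of a term in generators, and induction on terms applies.\<close>

lemma free_product_induct:
  fixes F :: "'l gorder" and L :: "'i \<Rightarrow> 'a gorder"
  assumes F: "is_free_product E I L F \<iota>" and V: "\<And>i. i \<in> I \<Longrightarrow> in_variety E (L i)"
    and ne: "I \<noteq> {}" and y: "y \<in> carrier F"
    and gen: "\<And>i x. i \<in> I \<Longrightarrow> x \<in> carrier (L i) \<Longrightarrow> P (\<iota> i x)"
    and join: "\<And>x y. \<lbrakk>x \<in> carrier F; y \<in> carrier F; P x; P y\<rbrakk> \<Longrightarrow> P (x \<squnion>\<^bsub>F\<^esub> y)"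
    and meet: "\<And>x y. \<lbrakk>x \<in> carrier F; y \<in> carrier F; P x; P y\<rbrakk> \<Longrightarrow> P (x \<sqinter>\<^bsub>F\<^esub> y)"
  shows "P y"
proof -
  have \<iota>: "lattice_hom (L i) F (\<iota> i)" if "i \<in> I" for i
    using F that by (simp add: is_free_product_def)
  have VF: "in_variety E F" using F by (simp add: is_free_product_def)
  then have latF: "lattice F" by (simp add: in_variety_def nonempty_lattice_def)
  obtain k c where k: "k \<in> I" "c \<in> carrier (L k)"
    using ne V unfolding in_variety_def nonempty_lattice_def by blast
  \<comment> \<open>Variables are pairs of an index and an element. Pairs that name no generator are
    sent to a fixed generator \<open>\<iota> k c\<close>, so that every variable takes a value
    satisfying \<open>P\<close>; this is where \<open>I\<close> must be nonempty.\<close>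
  define \<rho> where "\<rho> v = (case v of (i, x) \<Rightarrow> if i \<in> I \<and> x \<in> carrier (L i) then \<iota> i x else \<iota> k c)" for v
  have \<rho>: "range \<rho> \<subseteq> carrier F"
    using k lattice_homD(3)[OF \<iota>] by (auto simp: \<rho>_def)
  have P: "P (lterm_val F \<rho> t)" for t
  proof (induction t)
    case (LVar v)
    then show ?case using k gen by (auto simp: \<rho>_def split: prod.splits)
  qed (auto intro!: join meet lterm_val_closed[OF latF \<rho>])
  obtain A :: "('i \<times> 'a) lterm gorder" and e where
    e: "lattice_hom A F e" "inj_on e (carrier A)" "e ` carrier A = range (lterm_val F \<rho>)"
    using generated_copy[OF latF \<rho>] .
  have VA: "in_variety E A"
    by (rule in_variety_inj_hom[OF e(1,2) _ VF]) (use e(3) in auto)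
  have im: "\<iota> i x \<in> e ` carrier A" if "i \<in> I" "x \<in> carrier (L i)" for i x
    unfolding e(3) by (rule range_eqI[where x = "LVar (i, x)"]) (simp add: \<rho>_def that)
  have "lattice_hom (L i) A (inv_into (carrier A) e \<circ> \<iota> i)" if "i \<in> I" for i
    using \<iota>[OF that] im[OF that] by (auto intro!: lattice_hom_lift[OF e(1,2)])
  from universal_for_obtain[OF free_product_universal[OF F VA], OF this]
  obtain h where h: "lattice_hom F A h"
    "\<And>i x. i \<in> I \<Longrightarrow> x \<in> carrier (L i) \<Longrightarrow> h (\<iota> i x) = (inv_into (carrier A) e \<circ> \<iota> i) x"
    by blast
  \<comment> \<open>Both maps are endomorphisms of \<open>F\<close> that fix all generators. The
    equation puts \<open>y\<close> into the image of \<open>e\<close>.\<close>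
  have "(e \<circ> h) y = id y"
  proof (rule universal_for_unique[OF free_product_universal[OF F VF] \<iota> _ _ _ y])
    show "lattice_hom F F (e \<circ> h)" by (rule lattice_hom_comp[OF h(1) e(1)])
    show "lattice_hom F F id" using latF by (auto intro: lattice_homI)
    show "(e \<circ> h) (\<iota> i x) = id (\<iota> i x)" if "i \<in> I" "x \<in> carrier (L i)" for i x
      using h(2)[OF that] im[OF that] by (simp add: f_inv_into_f)
  qed
  moreover have "e (h y) \<in> range (lterm_val F \<rho>)"
    using lattice_homD(3)[OF h(1) y] e(3) by blast
  ultimately have "y \<in> range (lterm_val F \<rho>)" by simp
  then show ?thesis using P by auto
qed

section \<open>Extending the join homomorphisms to the free product\<close>

text \<open>The common core of the three cases of the theorem, which differ only in the choice of
  \<open>e\<close>.\<close>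

lemma join_hom_extension:
  fixes F :: "'l gorder" and L :: "'i \<Rightarrow> 'a gorder" and M :: "'m gorder"
  assumes W: "in_variety E W" "\<exists>x\<in>carrier W. \<exists>y\<in>carrier W. x \<noteq> y"
    and V: "\<And>i. i \<in> I \<Longrightarrow> in_variety E (L i)"
    and F: "is_free_product E I L F \<iota>"
    and M: "lattice M"
    and \<phi>: "\<And>i. i \<in> I \<Longrightarrow> join_hom (L i) M (\<phi> i)"
    and e: "e \<in> carrier M" "\<And>i x. i \<in> I \<Longrightarrow> x \<in> carrier (L i) \<Longrightarrow> e \<sqsubseteq>\<^bsub>M\<^esub> \<phi> i x"
  shows "\<exists>\<psi>. join_hom F M \<psi> \<and> (\<forall>i\<in>I. \<forall>x\<in>carrier (L i). \<psi> (\<iota> i x) = \<phi> i x)"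
proof -
  interpret M: lattice M by (rule M)
  have latL: "lattice (L i)" if "i \<in> I" for i
    using V[OF that] by (simp add: in_variety_def nonempty_lattice_def)
  have \<iota>: "lattice_hom (L i) F (\<iota> i)" if "i \<in> I" for i
    using F that by (simp add: is_free_product_def)
  have latF: "lattice F" using F by (simp add: is_free_product_def in_variety_def nonempty_lattice_def)
  have "\<exists>h. lattice_hom F (adjoin_bot (L i)) h \<and>
      (\<forall>j\<in>I. \<forall>x\<in>carrier (L j). h (\<iota> j x) = (if j = i then Some x else None))" if i: "i \<in> I" for i
  proof -
    define f :: "'i \<Rightarrow> 'a \<Rightarrow> 'a option" where "f j = (if j = i then Some else (\<lambda>_. None))" for j
    \<comment> \<open>Nontriviality of the variety enters here, and makes
      \<open>adjoin_bot (L i)\<close> an admissible target for the universal property.\<close>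
    have "in_variety E (adjoin_bot (L i))"
      using W(2) in_variety_adjoin_bot[OF W(1) _ _ _ V[OF i]] by blast
    moreover have "lattice_hom (L j) (adjoin_bot (L i)) (f j)" if "j \<in> I" for j
      using latL i that by (auto simp: f_def intro!: lattice_hom_Some lattice_hom_const lattice_adjoin_bot)
    ultimately obtain h where "lattice_hom F (adjoin_bot (L i)) h"
      "\<And>j x. j \<in> I \<Longrightarrow> x \<in> carrier (L j) \<Longrightarrow> h (\<iota> j x) = f j x"
      using universal_for_obtain[OF free_product_universal[OF F]] by metis
    then show ?thesis unfolding f_def by (intro exI[of _ h]) auto
  qed
  then obtain h where h: "\<And>i. i \<in> I \<Longrightarrow> lattice_hom F (adjoin_bot (L i)) (h i)"
    and h\<iota>: "\<And>i j x. \<lbrakk>i \<in> I; j \<in> I; x \<in> carrier (L j)\<rbrakk> \<Longrightarrow> h i (\<iota> j x) = (if j = i then Some x else None)"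
    by metis
  have hcl: "a \<in> carrier (L i)" if "i \<in> I" "x \<in> carrier F" "h i x = Some a" for i x a
    using lattice_homD(3)[OF h] that by (metis adjoin_bot_simps(2))
  have hjoin: "h i (x \<squnion>\<^bsub>F\<^esub> y) = bot_join (L i) (h i x) (h i y)"
    and hmeet: "h i (x \<sqinter>\<^bsub>F\<^esub> y) = bot_meet (L i) (h i x) (h i y)"
    if "i \<in> I" "x \<in> carrier F" "y \<in> carrier F" for i x y
    using that by (simp_all add: lattice_homD[OF h] adjoin_bot_join adjoin_bot_meet latL)
  \<comment> \<open>By induction over \<open>F\<close>: the support of a generator from
    \<open>L j\<close> lies in \<open>{j}\<close>, that of a join in the union of the two supports,
    and that of a meet in the first support. An empty \<open>I\<close> is treated apart because the
    induction needs a generator.\<close>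
  have fin: "finite {i \<in> I. h i x \<noteq> None}" if x: "x \<in> carrier F" for x
  proof (cases "I = {}")
    case False
    show ?thesis
    proof (rule free_product_induct[where P = "\<lambda>x. finite {i \<in> I. h i x \<noteq> None}", OF F V False x])
      fix j x assume "j \<in> I" "x \<in> carrier (L j)"
      then have "{i \<in> I. h i (\<iota> j x) \<noteq> None} \<subseteq> {j}" using h\<iota> by (auto split: if_splits)
      then show "finite {i \<in> I. h i (\<iota> j x) \<noteq> None}" using finite_subset by blast
    next
      fix x y assume xy: "x \<in> carrier F" "y \<in> carrier F"
        "finite {i \<in> I. h i x \<noteq> None}" "finite {i \<in> I. h i y \<noteq> None}"
      have "{i \<in> I. h i (x \<squnion>\<^bsub>F\<^esub> y) \<noteq> None} \<subseteq> {i \<in> I. h i x \<noteq> None} \<union> {i \<in> I. h i y \<noteq> None}"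
        using xy(1,2) by (auto simp: hjoin)
      then show "finite {i \<in> I. h i (x \<squnion>\<^bsub>F\<^esub> y) \<noteq> None}" using xy(3,4) finite_subset by blast
      have "{i \<in> I. h i (x \<sqinter>\<^bsub>F\<^esub> y) \<noteq> None} \<subseteq> {i \<in> I. h i x \<noteq> None}"
        using xy(1,2) by (auto simp: hmeet) (metis bot_meet.simps(2) not_None_eq)
      then show "finite {i \<in> I. h i (x \<sqinter>\<^bsub>F\<^esub> y) \<noteq> None}" using xy(3) finite_subset by blast
    qed
  qed simp
  \<comment> \<open>With \<open>e\<close> inserted, the set is nonempty even if every
    \<open>h i x\<close> is \<open>None\<close>, so its finite supremum exists in \<open>M\<close>
    although \<open>M\<close> may lack a least element.\<close>
  define S where "S x = insert e ((\<lambda>i. \<phi> i (the (h i x))) ` {i \<in> I. h i x \<noteq> None})" for x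
  define \<psi> where "\<psi> x = \<Squnion>\<^bsub>M\<^esub> (S x)" for x
  have \<phi>cl: "\<phi> i a \<in> carrier M" if "i \<in> I" "a \<in> carrier (L i)" for i a
    using \<phi>[OF that(1)] that(2) by (auto simp: join_hom_def)
  have \<phi>join: "\<phi> i (a \<squnion>\<^bsub>L i\<^esub> b) = \<phi> i a \<squnion>\<^bsub>M\<^esub> \<phi> i b"
    if "i \<in> I" "a \<in> carrier (L i)" "b \<in> carrier (L i)" for i a b
    using \<phi>[OF that(1)] that(2,3) by (auto simp: join_hom_def join_pres_def)
  have lub: "least M (\<psi> x) (Upper M (S x))" and SM: "S x \<subseteq> carrier M" if x: "x \<in> carrier F" for x
  proof -
    show "S x \<subseteq> carrier M" using e(1) \<phi>cl hcl[OF _ x] by (auto simp: S_def)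
    then show "least M (\<psi> x) (Upper M (S x))"
      unfolding \<psi>_def using fin[OF x] by (intro M.finite_sup_least) (auto simp: S_def)
  qed
  have \<psi>cl: "\<psi> x \<in> carrier M" if "x \<in> carrier F" for x
    using lub[OF that] by (rule least_closed)
  \<comment> \<open>\<open>\<psi> x\<close> is described by its upper bounds. The two remaining
    equations then follow through \<open>le_eqI\<close> by comparing upper bounds, without
    manipulating finite suprema.\<close>
  have \<psi>_le_iff: "\<psi> x \<sqsubseteq>\<^bsub>M\<^esub> u \<longleftrightarrow> e \<sqsubseteq>\<^bsub>M\<^esub> u \<and> (\<forall>i\<in>I. \<forall>a. h i x = Some a \<longrightarrow> \<phi> i a \<sqsubseteq>\<^bsub>M\<^esub> u)"
    if x: "x \<in> carrier F" and u: "u \<in> carrier M" for x u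
  proof -
    have "\<psi> x \<sqsubseteq>\<^bsub>M\<^esub> u \<longleftrightarrow> (\<forall>s\<in>S x. s \<sqsubseteq>\<^bsub>M\<^esub> u)"
    proof
      assume *: "\<psi> x \<sqsubseteq>\<^bsub>M\<^esub> u"
      show "\<forall>s\<in>S x. s \<sqsubseteq>\<^bsub>M\<^esub> u"
        using M.le_trans[OF least_Upper_above[OF lub[OF x] _ SM[OF x]] *] SM[OF x] \<psi>cl[OF x] u by blast
    next
      assume "\<forall>s\<in>S x. s \<sqsubseteq>\<^bsub>M\<^esub> u"
      then show "\<psi> x \<sqsubseteq>\<^bsub>M\<^esub> u"
        using u by (intro least_le[OF lub[OF x]]) (auto simp: Upper_def)
    qed
    then show ?thesis by (auto simp: S_def)
  qed
  have join_le_iff: "a \<squnion>\<^bsub>M\<^esub> b \<sqsubseteq>\<^bsub>M\<^esub> u \<longleftrightarrow> a \<sqsubseteq>\<^bsub>M\<^esub> u \<and> b \<sqsubseteq>\<^bsub>M\<^esub> u"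
    if "a \<in> carrier M" "b \<in> carrier M" "u \<in> carrier M" for a b u
    using that M.join_left M.join_right M.join_le M.le_trans M.join_closed by metis
  have le_eqI: "p = q" if "p \<in> carrier M" "q \<in> carrier M"
      "\<And>u. u \<in> carrier M \<Longrightarrow> p \<sqsubseteq>\<^bsub>M\<^esub> u \<longleftrightarrow> q \<sqsubseteq>\<^bsub>M\<^esub> u" for p q
    using that M.le_antisym M.le_refl by metis
  have "\<psi> (x \<squnion>\<^bsub>F\<^esub> y) = \<psi> x \<squnion>\<^bsub>M\<^esub> \<psi> y" if xy: "x \<in> carrier F" "y \<in> carrier F" for x y
  proof (rule le_eqI)
    fix u assume u: "u \<in> carrier M"
    have xyF: "x \<squnion>\<^bsub>F\<^esub> y \<in> carrier F" by (rule lattice_join_closed[OF latF xy])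
    \<comment> \<open>If both values are proper, \<open>\<phi> i\<close> turns their join into a
      join in \<open>M\<close>; if one is \<open>None\<close>, the join is the other value and the
      condition on \<open>None\<close> is vacuous.\<close>
    have "(\<forall>a. h i (x \<squnion>\<^bsub>F\<^esub> y) = Some a \<longrightarrow> \<phi> i a \<sqsubseteq>\<^bsub>M\<^esub> u) \<longleftrightarrow>
        (\<forall>a. h i x = Some a \<longrightarrow> \<phi> i a \<sqsubseteq>\<^bsub>M\<^esub> u) \<and> (\<forall>a. h i y = Some a \<longrightarrow> \<phi> i a \<sqsubseteq>\<^bsub>M\<^esub> u)"
      if i: "i \<in> I" for i
      using hcl[OF i xy(1)] hcl[OF i xy(2)] u
      by (cases "h i x"; cases "h i y") (auto simp: hjoin[OF i xy] \<phi>join[OF i] join_le_iff \<phi>cl[OF i])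
    then show "\<psi> (x \<squnion>\<^bsub>F\<^esub> y) \<sqsubseteq>\<^bsub>M\<^esub> u \<longleftrightarrow> \<psi> x \<squnion>\<^bsub>M\<^esub> \<psi> y \<sqsubseteq>\<^bsub>M\<^esub> u"
      unfolding join_le_iff[OF \<psi>cl[OF xy(1)] \<psi>cl[OF xy(2)] u] \<psi>_le_iff[OF xyF u]
        \<psi>_le_iff[OF xy(1) u] \<psi>_le_iff[OF xy(2) u] by blast
  qed (use xy \<psi>cl lattice_join_closed[OF latF] in auto)
  then have "join_hom F M \<psi>"
    using \<psi>cl latF M by (auto simp: join_hom_def join_pres_def)
  moreover have "\<psi> (\<iota> i x) = \<phi> i x" if ix: "i \<in> I" "x \<in> carrier (L i)" for i x
  proof (rule le_eqI)
    have F': "\<iota> i x \<in> carrier F" using lattice_homD(3)[OF \<iota>] ix by blast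
    then show "\<psi> (\<iota> i x) \<in> carrier M" by (rule \<psi>cl)
    fix u assume u: "u \<in> carrier M"
    \<comment> \<open>At \<open>\<iota> i x\<close> only the index \<open>i\<close> contributes, so
      \<open>\<psi>_le_iff\<close> leaves the bounds on \<open>e\<close> and on
      \<open>\<phi> i x\<close>. The former is implied by the latter because \<open>e\<close> is a
      lower bound of the images.\<close>
    have "e \<sqsubseteq>\<^bsub>M\<^esub> u" if "\<phi> i x \<sqsubseteq>\<^bsub>M\<^esub> u"
      using M.le_trans[OF e(2)[OF ix] that e(1) \<phi>cl[OF ix] u] .
    then show "\<psi> (\<iota> i x) \<sqsubseteq>\<^bsub>M\<^esub> u \<longleftrightarrow> \<phi> i x \<sqsubseteq>\<^bsub>M\<^esub> u"
      unfolding \<psi>_le_iff[OF F' u] using ix by (auto simp: h\<iota>)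
  qed (rule \<phi>cl[OF ix])
  ultimately show ?thesis by blast
qed

section \<open>Finding the common lower bound\<close>

theorem proposition12:
  fixes E :: identities and W :: "'w gorder"
    and I :: "'i set" and L :: "'i \<Rightarrow> 'a gorder"
    and F :: "'l gorder" and \<iota> :: "'i \<Rightarrow> 'a \<Rightarrow> 'l"
    and M :: "'m gorder" and \<phi> :: "'i \<Rightarrow> 'a \<Rightarrow> 'm"
  assumes nontrivial: "in_variety E W" "\<exists>x\<in>carrier W. \<exists>y\<in>carrier W. x \<noteq> y"
    and family: "\<And>i. i \<in> I \<Longrightarrow> in_variety E (L i)"
    and free: "is_free_product E I L F \<iota>"
    and M: "nonempty_lattice M"
    and \<phi>: "\<And>i. i \<in> I \<Longrightarrow> join_hom (L i) M (\<phi> i)"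
  shows "((\<exists>e. e \<in> Lower M (\<Union>i\<in>I. \<phi> i ` carrier (L i))) \<longrightarrow>
            (\<exists>\<psi>. join_hom F M \<psi> \<and> (\<forall>i\<in>I. \<forall>x\<in>carrier (L i). \<psi> (\<iota> i x) = \<phi> i x)))
       \<and> ((\<exists>b. least M b (carrier M)) \<longrightarrow>
            (\<exists>\<psi>. join_hom F M \<psi> \<and> (\<forall>i\<in>I. \<forall>x\<in>carrier (L i). \<psi> (\<iota> i x) = \<phi> i x)))
       \<and> (finite I \<and> (\<forall>i\<in>I. \<exists>b. least (L i) b (carrier (L i))) \<longrightarrow>
            (\<exists>\<psi>. join_hom F M \<psi> \<and> (\<forall>i\<in>I. \<forall>x\<in>carrier (L i). \<psi> (\<iota> i x) = \<phi> i x)))"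
proof (intro conjI impI)
  let ?ext = "\<exists>\<psi>. join_hom F M \<psi> \<and> (\<forall>i\<in>I. \<forall>x\<in>carrier (L i). \<psi> (\<iota> i x) = \<phi> i x)"
  have latM: "lattice M" and neM: "carrier M \<noteq> {}" using M by (auto simp: nonempty_lattice_def)
  interpret M: lattice M by (rule latM)
  have extend: ?ext if "e \<in> carrier M" "\<And>i x. i \<in> I \<Longrightarrow> x \<in> carrier (L i) \<Longrightarrow> e \<sqsubseteq>\<^bsub>M\<^esub> \<phi> i x" for e
    by (rule join_hom_extension[OF nontrivial family free latM \<phi> that])
  have \<phi>cl: "\<phi> i x \<in> carrier M" if "i \<in> I" "x \<in> carrier (L i)" for i x
    using \<phi>[OF that(1)] that(2) by (auto simp: join_hom_def)
  show ?ext if "\<exists>e. e \<in> Lower M (\<Union>i\<in>I. \<phi> i ` carrier (L i))"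
  proof -
    from that obtain e where e: "e \<in> Lower M (\<Union>i\<in>I. \<phi> i ` carrier (L i))" ..
    show ?ext
    proof (rule extend)
      show "e \<in> carrier M" using e by (simp add: Lower_def)
      fix i x assume ix: "i \<in> I" "x \<in> carrier (L i)"
      \<comment> \<open>\<open>Lower M\<close> constrains only those elements of the given set that
        lie in the carrier, hence the intersection.\<close>
      then have "\<phi> i x \<in> (\<Union>i\<in>I. \<phi> i ` carrier (L i)) \<inter> carrier M" using \<phi>cl by blast
      then show "e \<sqsubseteq>\<^bsub>M\<^esub> \<phi> i x" using e unfolding Lower_def by blast
    qed
  qed
  show ?ext if "\<exists>b. least M b (carrier M)"
  proof -
    from that obtain b where "least M b (carrier M)" ..
    then have "b \<in> carrier M" "\<And>x. x \<in> carrier M \<Longrightarrow> b \<sqsubseteq>\<^bsub>M\<^esub> x" by (auto simp: least_def)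
    then show ?ext using \<phi>cl by (intro extend[of b]) auto
  qed
  show ?ext if "finite I \<and> (\<forall>i\<in>I. \<exists>b. least (L i) b (carrier (L i)))"
  proof (cases "I = {}")
    \<comment> \<open>With no factors, any element of the nonempty \<open>M\<close> can serve as
      \<open>e\<close>. The case is separate because the finite meet used below requires a nonempty
      set.\<close>
    case True
    then show ?ext using neM extend by blast
  next
    case False
    from that obtain b where "\<And>i. i \<in> I \<Longrightarrow> least (L i) (b i) (carrier (L i))" by metis
    then have b: "b i \<in> carrier (L i)" "\<And>x. x \<in> carrier (L i) \<Longrightarrow> b i \<sqsubseteq>\<^bsub>L i\<^esub> x" if "i \<in> I" for i
      using that by (auto simp: least_def)
    \<comment> \<open>A join homomorphism is isotone, so \<open>\<phi> i (b i)\<close> is least in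
      the image of \<open>\<phi> i\<close>. As \<open>I\<close> is finite, the meet of these
      elements exists in \<open>M\<close> and bounds all images from below.\<close>
    let ?B = "(\<lambda>i. \<phi> i (b i)) ` I"
    have B: "?B \<subseteq> carrier M" using \<phi>cl b(1) by auto
    then have glb: "greatest M (\<Sqinter>\<^bsub>M\<^esub> ?B) (Lower M ?B)"
      using that False by (intro M.finite_inf_greatest) auto
    then have cl: "\<Sqinter>\<^bsub>M\<^esub> ?B \<in> carrier M" by (rule greatest_closed)
    show ?ext
    proof (rule extend)
      fix i x assume ix: "i \<in> I" "x \<in> carrier (L i)"
      have "\<Sqinter>\<^bsub>M\<^esub> ?B \<sqsubseteq>\<^bsub>M\<^esub> \<phi> i (b i)"
        using ix by (intro greatest_Lower_below[OF glb _ B]) auto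
      moreover have "isotone (L i) M (\<phi> i)"
        using \<phi>[OF ix(1)] by (auto simp: join_hom_def intro: join_pres_isotone)
      then have "\<phi> i (b i) \<sqsubseteq>\<^bsub>M\<^esub> \<phi> i x"
        by (rule use_iso2[OF _ b(1)[OF ix(1)] ix(2) b(2)[OF ix]])
      ultimately show "\<Sqinter>\<^bsub>M\<^esub> ?B \<sqsubseteq>\<^bsub>M\<^esub> \<phi> i x"
        by (rule M.le_trans[OF _ _ cl \<phi>cl[OF ix(1) b(1)[OF ix(1)]] \<phi>cl[OF ix]])
    qed (use cl in auto)
  qed
qed

end
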